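(* Let $s>1$ and $t>1$ be integers and let $\beta_{s,t}$ be the type-$\beta$ comb with $s$ teeth of length $t$. Then no linear extension of $\beta_{s,t}$ avoids the pattern $123$; i.e., the number of $123$-avoiding linear extensions of $\beta_{s,t}$ is $0$.
   Context: A linear extension of a finite poset $P$ on a set of integers is a listing $v=[v_1,\dots,v_n]$ of all elements of $P$, each exactly once, such that whenever $a \leq_P b$, $a$ appears before $b$. For $w \in S_3$, a sequence $v$ of distinct integers contains $w$ if there are indices $i<j<k$ with $(v_i,v_j,v_k)$ in the same relative order as $(w_1,w_2,w_3)$; otherwise $v$ avoids $w$. The type-$\beta$ comb $\beta_{s,t}$ is the poset on $\{1,\dots,st\}$ whose order is generated by the relations $ct+1 \leq (c+1)t+1$ for $0 \leq c \leq s-2$ (the spine) and $ct+j \leq ct+j+1$ for $0 \leq c \leq s-1$, $1 \leq j \leq t-1$ (the teeth $\{ct+1,\dots,ct+t\}$). *)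

theory Defs
  imports Main
begin

(* A poset is given by its carrier A and its (reflexive) order relation r,
   to be used with partial_order_on A r. *)
definition is_linear_extension :: "'a set \<Rightarrow> 'a rel \<Rightarrow> 'a list \<Rightarrow> bool" where
  "is_linear_extension A r v \<longleftrightarrow>
     distinct v \<and> set v = A \<and>
     (\<forall>i < length v. \<forall>j < length v. (v ! i, v ! j) \<in> r \<longrightarrow> i \<le> j)"

definition same_relative_order :: "'a::linorder list \<Rightarrow> 'b::linorder list \<Rightarrow> bool" where
  "same_relative_order xs ys \<longleftrightarrow>
     length xs = length ys \<and>
     (\<forall>p < length xs. \<forall>q < length xs. xs ! p < xs ! q \<longleftrightarrow> ys ! p < ys ! q)"

(* Patterns are elements of S_3, written in one-line notation, e.g. [1, 2, 3]. *)
definition contains_pattern :: "'a::linorder list \<Rightarrow> nat list \<Rightarrow> bool" where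
  "contains_pattern v w \<longleftrightarrow>
     (\<exists>i j k. i < j \<and> j < k \<and> k < length v \<and>
        same_relative_order [v ! i, v ! j, v ! k] w)"

abbreviation avoids_pattern :: "'a::linorder list \<Rightarrow> nat list \<Rightarrow> bool" where
  "avoids_pattern v w \<equiv> \<not> contains_pattern v w"

definition beta_carrier :: "nat \<Rightarrow> nat \<Rightarrow> nat set" where
  "beta_carrier s t = {1..s * t}"

definition beta_spine :: "nat \<Rightarrow> nat \<Rightarrow> nat rel" where
  "beta_spine s t = {(c * t + 1, (c + 1) * t + 1) | c. c + 2 \<le> s}"

definition beta_teeth :: "nat \<Rightarrow> nat \<Rightarrow> nat rel" where
  "beta_teeth s t =
     {(c * t + j, c * t + j + 1) | c j. c + 1 \<le> s \<and> 1 \<le> j \<and> j + 1 \<le> t}"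

definition beta_order :: "nat \<Rightarrow> nat \<Rightarrow> nat rel" where
  "beta_order s t =
     (beta_spine s t \<union> beta_teeth s t)\<^sup>* \<inter> (beta_carrier s t \<times> beta_carrier s t)"

lemma beta_generators_in_carrier:
  assumes "t \<ge> 1"
  shows "beta_spine s t \<union> beta_teeth s t \<subseteq> beta_carrier s t \<times> beta_carrier s t"
proof -
  have spine: "(c + 1) * t + 1 \<le> s * t" if "c + 2 \<le> s" for c
  proof -
    have "(c + 2) * t \<le> s * t" using that by (rule mult_le_mono1)
    then show ?thesis using assms by (simp add: algebra_simps)
  qed
  have teeth: "c * t + j + 1 \<le> s * t" if "c + 1 \<le> s" "j + 1 \<le> t" for c j
  proof -
    have "(c + 1) * t \<le> s * t" using that(1) by (rule mult_le_mono1)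
    then show ?thesis using that(2) by (simp add: algebra_simps)
  qed
  have "beta_spine s t \<subseteq> beta_carrier s t \<times> beta_carrier s t"
    unfolding beta_spine_def beta_carrier_def using spine by fastforce
  moreover have "beta_teeth s t \<subseteq> beta_carrier s t \<times> beta_carrier s t"
    unfolding beta_teeth_def beta_carrier_def using teeth by fastforce
  ultimately show ?thesis by blast
qed

lemma beta_order_imp_le:
  assumes "(a, b) \<in> beta_order s t"
  shows "a \<le> b"
proof -
  have "(a, b) \<in> (beta_spine s t \<union> beta_teeth s t)\<^sup>*"
    using assms by (simp add: beta_order_def)
  then show ?thesis
    by (induction rule: rtrancl_induct) (auto simp: beta_spine_def beta_teeth_def)
qed

lemma partial_order_on_beta_order:
  "partial_order_on (beta_carrier s t) (beta_order s t)"
proof -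
  have "refl_on (beta_carrier s t) (beta_order s t)"
    by (auto simp: refl_on_def beta_order_def)
  moreover have "trans (beta_order s t)"
    by (auto simp: trans_def beta_order_def)
  moreover have "antisym (beta_order s t)"
    by (auto intro: antisymI dest: beta_order_imp_le le_antisym)
  moreover have "beta_order s t \<subseteq> beta_carrier s t \<times> beta_carrier s t"
    by (auto simp: beta_order_def)
  ultimately show ?thesis
    by (simp add: partial_order_on_def preorder_on_def)
qed

end

theory Submission
  imports Defs
begin

(* The chain 1 < t+1 < t+2 of the comb (a spine relation followed by a relation of the second
   tooth) must appear in this order in every linear extension, and is an occurrence of 123. *)

text \<open>Three elements of a poset that form a chain and whose labels also increase keep their
  order in every linear extension, so they force a 123 there
  (\<open>linear_extension_contains_123\<close>). With two teeth of length at least two, the comb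
  has such a chain: from the root 1 along the spine to t+1, then one step up that tooth to
  t+2.\<close>

lemma same_relative_order_123:
  assumes "a < b" and "b < c"
  shows "same_relative_order [a, b, c] [1, 2, 3 :: nat]"
  using assms less_trans[OF assms]
  by (simp add: same_relative_order_def All_less_Suc less_imp_not_less)

text \<open>The order is reflexive, so \<open>is_linear_extension\<close> yields only a weak
  inequality of positions; distinct entries rule out equal positions.\<close>

lemma linear_extension_nth_less:
  assumes v: "is_linear_extension A r v"
    and r: "(v ! i, v ! j) \<in> r" and "v ! i \<noteq> v ! j" "i < length v" "j < length v"
  shows "i < j"
proof -
  have "i \<le> j" using v r assms(4,5) unfolding is_linear_extension_def by blast
  moreover have "i \<noteq> j" using assms(3) by blast
  ultimately show ?thesis by simp
qed

lemma linear_extension_contains_123: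
  assumes v: "is_linear_extension A r v"
    and A: "a \<in> A" "b \<in> A" "c \<in> A"
    and r: "(a, b) \<in> r" "(b, c) \<in> r"
    and less: "a < b" "b < c"
  shows "contains_pattern v [1, 2, 3]"
proof -
  have set: "set v = A" using v by (simp add: is_linear_extension_def)
  obtain i where i: "i < length v" "v ! i = a" using A(1) set by (auto simp: in_set_conv_nth)
  obtain j where j: "j < length v" "v ! j = b" using A(2) set by (auto simp: in_set_conv_nth)
  obtain k where k: "k < length v" "v ! k = c" using A(3) set by (auto simp: in_set_conv_nth)
  have "i < j"
    using linear_extension_nth_less[OF v, of i j] i j r(1) less(1) by simp
  moreover have "j < k"
    using linear_extension_nth_less[OF v, of j k] j k r(2) less(2) by simp
  moreover have "same_relative_order [v ! i, v ! j, v ! k] [1, 2, 3 :: nat]"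
    unfolding i j k using less by (rule same_relative_order_123)
  ultimately show ?thesis
    using k(1) unfolding contains_pattern_def by blast
qed

text \<open>\<open>beta_order\<close> is the closure cut down to the carrier, so a generator belongs
  to it only once both endpoints are known to lie in the carrier.\<close>

lemma beta_order_generator:
  assumes "t \<ge> 1" and "(a, b) \<in> beta_spine s t \<union> beta_teeth s t"
  shows "(a, b) \<in> beta_order s t"
  using assms beta_generators_in_carrier[OF assms(1), of s]
  unfolding beta_order_def by blast

theorem theorem7:
  fixes s t :: nat
  assumes "s > 1" and "t > 1"
  shows "(\<nexists>v. is_linear_extension (beta_carrier s t) (beta_order s t) v \<and>
              avoids_pattern v [1, 2, 3]) \<and>
         card {v. is_linear_extension (beta_carrier s t) (beta_order s t) v \<and>
                  avoids_pattern v [1, 2, 3]} = 0"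
proof -
  \<comment> \<open>The unsimplified terms display the witness c = 0, admissible because s >
    1.\<close>
  have "(0 * t + 1, (0 + 1) * t + 1) \<in> beta_spine s t"
    unfolding beta_spine_def using assms by force
  then have spine: "(1, t + 1) \<in> beta_order s t"
    using assms by (intro beta_order_generator) auto
  \<comment> \<open>Here c = 1 and j = 1: a second tooth exists by s > 1, and it has a second
    element by t > 1.\<close>
  have "(1 * t + 1, 1 * t + 1 + 1) \<in> beta_teeth s t"
    unfolding beta_teeth_def using assms by force
  then have tooth: "(t + 1, t + 2) \<in> beta_order s t"
    using assms by (intro beta_order_generator) auto
  have "1 \<in> beta_carrier s t" "t + 1 \<in> beta_carrier s t" "t + 2 \<in> beta_carrier s t"
    using spine tooth by (auto simp: beta_order_def)
  then have "contains_pattern v [1, 2, 3]"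
    if "is_linear_extension (beta_carrier s t) (beta_order s t) v" for v
    using linear_extension_contains_123[OF that _ _ _ spine tooth] assms by simp
  then have none: "\<nexists>v. is_linear_extension (beta_carrier s t) (beta_order s t) v \<and>
              avoids_pattern v [1, 2, 3]" by blast
  \<comment> \<open>Since \<open>card\<close> is 0 on infinite sets too, the count is read off from
    actual emptiness.\<close>
  then have "{v. is_linear_extension (beta_carrier s t) (beta_order s t) v \<and>
                  avoids_pattern v [1, 2, 3]} = {}" by blast
  with none show ?thesis by (simp only: card.empty simp_thms)
qed

end
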